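(* Let $\kappa<\lambda$ be two infinite cardinals. Then there is no embedding (i.e. no injective group homomorphism) of the alternating group $\mathrm{Alt}(\lambda)$ into the symmetric group $\mathrm{Sym}(\kappa)$.
   Context: For a cardinal $\kappa$, $\mathrm{Sym}(\kappa)$ is the group of all bijections $\kappa\to\kappa$ under composition. The support of $f\in\mathrm{Sym}(\kappa)$ is $\mathrm{supp}(f)=\{x\in\kappa: f(x)\neq x\}$. A transposition is a permutation with two-element support. A permutation is even if it can be written as a composition of an even number of transpositions (in particular it has finite support). $\mathrm{Alt}(\kappa)$ is the subgroup of $\mathrm{Sym}(\kappa)$ consisting of all even permutations. *)

theory Defs
  imports "HOL-Algebra.Bij"
begin

unbundle cardinal_syntax

text \<open>
  A cardinal is a cardinal order \<open>r\<close>; its underlying set is \<open>Field r\<close>. The group \<open>Sym(X)\<close> of all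
  bijections of a set \<open>X\<close> is \<^term>\<open>BijGroup X\<close>, whose elements are extensional outside \<open>X\<close>
  (so not the identity there); hence the support is taken inside \<open>X\<close>.
\<close>

definition supp :: "'a set \<Rightarrow> ('a \<Rightarrow> 'a) \<Rightarrow> 'a set"
  where "supp X f = {x \<in> X. f x \<noteq> x}"

definition transpositions :: "'a set \<Rightarrow> ('a \<Rightarrow> 'a) set"
  where "transpositions X = {f \<in> carrier (BijGroup X). card (supp X f) = 2}"

definition comp_list :: "'a set \<Rightarrow> ('a \<Rightarrow> 'a) list \<Rightarrow> 'a \<Rightarrow> 'a"
  where "comp_list X ts = foldr (\<otimes>\<^bsub>BijGroup X\<^esub>) ts \<one>\<^bsub>BijGroup X\<^esub>"

definition even_perms :: "'a set \<Rightarrow> ('a \<Rightarrow> 'a) set"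
  where "even_perms X =
    {comp_list X ts | ts. set ts \<subseteq> transpositions X \<and> even (length ts)}"

definition AltGroup :: "'a set \<Rightarrow> ('a \<Rightarrow> 'a) monoid"
  where "AltGroup X = (BijGroup X)\<lparr>carrier := even_perms X\<rparr>"

lemma comp_list_closed:
  "set ts \<subseteq> transpositions X \<Longrightarrow> comp_list X ts \<in> carrier (BijGroup X)"
proof (induction ts)
  case Nil
  interpret group "BijGroup X" by (rule group_BijGroup)
  show ?case by (simp add: comp_list_def)
next
  case (Cons t ts)
  interpret group "BijGroup X" by (rule group_BijGroup)
  from Cons show ?case by (simp add: comp_list_def transpositions_def)
qed

lemma comp_list_append:
  assumes "set ss \<subseteq> transpositions X" "set ts \<subseteq> transpositions X"
  shows "comp_list X (ss @ ts) = comp_list X ss \<otimes>\<^bsub>BijGroup X\<^esub> comp_list X ts"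
  using assms(1)
proof (induction ss)
  case Nil
  interpret group "BijGroup X" by (rule group_BijGroup)
  show ?case using comp_list_closed[OF assms(2)] by (simp add: comp_list_def)
next
  case (Cons s ss)
  interpret group "BijGroup X" by (rule group_BijGroup)
  have s: "s \<in> carrier (BijGroup X)" using Cons.prems by (auto simp: transpositions_def)
  have ss: "set ss \<subseteq> transpositions X" using Cons.prems by simp
  have "comp_list X ((s # ss) @ ts)
      = s \<otimes>\<^bsub>BijGroup X\<^esub> (comp_list X ss \<otimes>\<^bsub>BijGroup X\<^esub> comp_list X ts)"
    using Cons.IH[OF ss] by (simp add: comp_list_def)
  also have "\<dots> = (s \<otimes>\<^bsub>BijGroup X\<^esub> comp_list X ss) \<otimes>\<^bsub>BijGroup X\<^esub> comp_list X ts"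
    using m_assoc[OF s comp_list_closed[OF ss] comp_list_closed[OF assms(2)]] by simp
  finally show ?case by (simp add: comp_list_def)
qed

lemma transpositions_inv:
  assumes "t \<in> transpositions X"
  shows "inv\<^bsub>BijGroup X\<^esub> t \<in> transpositions X"
proof -
  interpret group "BijGroup X" by (rule group_BijGroup)
  let ?u = "inv\<^bsub>BijGroup X\<^esub> t"
  have t: "t \<in> carrier (BijGroup X)" and u: "?u \<in> carrier (BijGroup X)"
    using assms by (auto simp: transpositions_def)
  have tB: "t \<in> Bij X" and uB: "?u \<in> Bij X"
    using t u by (auto simp: BijGroup_def)
  have comp: "compose X t ?u = (\<lambda>x\<in>X. x)" "compose X ?u t = (\<lambda>x\<in>X. x)"
    using r_inv[OF t] l_inv[OF t] tB uB by (auto simp: BijGroup_def)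
  have tu: "t (?u x) = x" "?u (t x) = x" if "x \<in> X" for x
    using fun_cong[OF comp(1), of x] fun_cong[OF comp(2), of x] that
    by (simp_all add: compose_def)
  have "supp X ?u = supp X t"
    unfolding supp_def using tu by force
  then show ?thesis using assms u by (simp add: transpositions_def)
qed

lemma comp_list_inv:
  assumes "set ts \<subseteq> transpositions X"
  shows "inv\<^bsub>BijGroup X\<^esub> (comp_list X ts)
    = comp_list X (rev (map (\<lambda>t. inv\<^bsub>BijGroup X\<^esub> t) ts))"
  using assms
proof (induction ts)
  case Nil
  interpret group "BijGroup X" by (rule group_BijGroup)
  show ?case by (simp add: comp_list_def)
next
  case (Cons t ts)
  interpret group "BijGroup X" by (rule group_BijGroup)
  let ?i = "\<lambda>t. inv\<^bsub>BijGroup X\<^esub> t"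
  have t: "t \<in> carrier (BijGroup X)" and tT: "t \<in> transpositions X"
    and ts: "set ts \<subseteq> transpositions X"
    using Cons.prems by (auto simp: transpositions_def)
  have r: "set (rev (map ?i ts)) \<subseteq> transpositions X"
    using ts transpositions_inv by auto
  have "comp_list X (rev (map ?i ts) @ [?i t])
      = comp_list X (rev (map ?i ts)) \<otimes>\<^bsub>BijGroup X\<^esub> comp_list X [?i t]"
    using comp_list_append[OF r] transpositions_inv[OF tT] by simp
  also have "\<dots> = ?i (comp_list X ts) \<otimes>\<^bsub>BijGroup X\<^esub> ?i t"
    using Cons.IH[OF ts] t by (simp add: comp_list_def)
  also have "\<dots> = ?i (t \<otimes>\<^bsub>BijGroup X\<^esub> comp_list X ts)"
    using inv_mult_group[OF t comp_list_closed[OF ts]] by simp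
  finally show ?case by (simp add: comp_list_def)
qed

lemma subgroup_even_perms: "subgroup (even_perms X) (BijGroup X)"
proof -
  interpret group "BijGroup X" by (rule group_BijGroup)
  show ?thesis
  proof (rule subgroupI)
    show "even_perms X \<subseteq> carrier (BijGroup X)"
      using comp_list_closed by (auto simp: even_perms_def)
    have "comp_list X [] \<in> even_perms X"
      unfolding even_perms_def by (intro CollectI exI[of _ "[]"]) simp
    then show "even_perms X \<noteq> {}" by blast
  next
    fix f assume "f \<in> even_perms X"
    then obtain ts where ts: "f = comp_list X ts" "set ts \<subseteq> transpositions X" "even (length ts)"
      by (auto simp: even_perms_def)
    then show "inv\<^bsub>BijGroup X\<^esub> f \<in> even_perms X"
      unfolding even_perms_def
      by (intro CollectI exI[of _ "rev (map (\<lambda>t. inv\<^bsub>BijGroup X\<^esub> t) ts)"])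
        (auto simp: comp_list_inv transpositions_inv)
  next
    fix f g assume "f \<in> even_perms X" "g \<in> even_perms X"
    then obtain ss ts where
      "f = comp_list X ss" "set ss \<subseteq> transpositions X" "even (length ss)"
      "g = comp_list X ts" "set ts \<subseteq> transpositions X" "even (length ts)"
      by (auto simp: even_perms_def)
    then show "f \<otimes>\<^bsub>BijGroup X\<^esub> g \<in> even_perms X"
      unfolding even_perms_def
      by (intro CollectI exI[of _ "ss @ ts"]) (auto simp: comp_list_append)
  qed
qed

lemma group_AltGroup: "group (AltGroup X)"
  unfolding AltGroup_def
  using subgroup_even_perms group_BijGroup by (rule subgroup.subgroup_is_group)

end

theory Submission
  imports Defs "HOL-Combinatorics.Transposition"
begin

text \<open>
  Let \<open>Alt(X)\<close> act on \<open>Y\<close> through a homomorphism \<open>\<phi>\<close>, where \<open>Y\<close> is infinite and \<open>|Y| < |X|\<close>.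
  The claim is that every 3-cycle \<open>(r p q) = (r p) (p q)\<close> acts trivially, so that \<open>\<phi>\<close> is not injective.

  Fix \<open>t \<in> Y\<close> and an arbitrary transposition \<open>\<sigma>\<close>. For \<open>a \<in> {p, q, r}\<close> and \<open>x \<in> X - {p, q, r}\<close> the
  permutation \<open>\<sigma> (a x)\<close> is even, so it sends \<open>t\<close> to some point of \<open>Y\<close>. Recording these
  points for the three values of \<open>a\<close> colours \<open>X - {p, q, r}\<close> with elements of \<open>Y \<times> Y \<times> Y\<close>, a set of
  cardinality \<open>|Y| < |X|\<close>. Hence two points \<open>x \<noteq> y\<close> receive the same colour (\<open>pigeonhole_triple\<close>).
  For each \<open>a\<close> the quotient \<open>(\<sigma> (a x))\<^sup>-\<^sup>1 \<sigma> (a y) = (a x) (a y)\<close>, a 3-cycle on \<open>{a, x, y}\<close> in which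
  \<open>\<sigma>\<close> has cancelled, therefore fixes \<open>t\<close> (\<open>equal_images_fix\<close>), and so does its inverse \<open>(a y) (a x)\<close>.

  The three 3-cycles obtained in this way generate the alternating group on \<open>{p, q, r, x, y}\<close>, so
  \<open>(r p q)\<close> fixes \<open>t\<close> as well; \<open>three_cycle_word\<close> gives an explicit word. The points \<open>x\<close> and \<open>y\<close> depend
  on \<open>t\<close>, but \<open>(r p q)\<close> does not, and so it fixes every \<open>t \<in> Y\<close>.
\<close>

section \<open>Products of two transpositions\<close>

definition transp :: "'a set \<Rightarrow> 'a \<Rightarrow> 'a \<Rightarrow> 'a \<Rightarrow> 'a"
  where "transp X a b = (\<lambda>z\<in>X. transpose a b z)"

definition transp2 :: "'a set \<Rightarrow> 'a \<Rightarrow> 'a \<Rightarrow> 'a \<Rightarrow> 'a \<Rightarrow> 'a \<Rightarrow> 'a"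
  where "transp2 X a b c d = transp X a b \<otimes>\<^bsub>BijGroup X\<^esub> transp X c d"

lemma transpose_in: "a \<in> X \<Longrightarrow> b \<in> X \<Longrightarrow> z \<in> X \<Longrightarrow> transpose a b z \<in> X"
  by (auto simp: transpose_def)

lemma transp_carrier:
  assumes "a \<in> X" "b \<in> X"
  shows "transp X a b \<in> carrier (BijGroup X)"
proof -
  have "bij_betw (transpose a b) X X"
    by (rule bij_betwI[where g = "transpose a b"]) (auto intro: transpose_in[OF assms])
  then show ?thesis
    by (simp add: BijGroup_def Bij_def transp_def bij_betw_restrict_eq)
qed

lemma transp_transpositions:
  assumes "a \<in> X" "b \<in> X" "a \<noteq> b"
  shows "transp X a b \<in> transpositions X"
proof -
  have "supp X (transp X a b) = {a, b}"
    using assms by (auto simp: supp_def transp_def transpose_def)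
  then show ?thesis
    using assms by (simp add: transpositions_def transp_carrier)
qed

lemma transp2_even:
  assumes "{a, b, c, d} \<subseteq> X" "a \<noteq> b" "c \<noteq> d"
  shows "transp2 X a b c d \<in> even_perms X"
proof -
  interpret group "BijGroup X" by (rule group_BijGroup)
  have "transp2 X a b c d = comp_list X [transp X a b, transp X c d]"
    using assms by (simp add: transp2_def comp_list_def transp_carrier)
  moreover have "set [transp X a b, transp X c d] \<subseteq> transpositions X"
    using assms by (simp add: transp_transpositions)
  ultimately show ?thesis
    unfolding even_perms_def by force
qed

lemma transp2_carrier:
  assumes "{a, b, c, d} \<subseteq> X"
  shows "transp2 X a b c d \<in> carrier (BijGroup X)"
proof -
  interpret group "BijGroup X" by (rule group_BijGroup)
  show ?thesis
    using assms by (simp add: transp2_def transp_carrier)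
qed

lemma BijGroup_mult_apply:
  assumes "g \<in> carrier (BijGroup X)" "h \<in> carrier (BijGroup X)" "z \<in> X"
  shows "(g \<otimes>\<^bsub>BijGroup X\<^esub> h) z = g (h z)"
  using assms by (simp add: BijGroup_def compose_eq)

lemma transp2_apply:
  assumes "{a, b, c, d} \<subseteq> X" "z \<in> X"
  shows "transp2 X a b c d z = transpose a b (transpose c d z)"
  using assms
  by (simp add: transp2_def BijGroup_mult_apply transp_carrier)
    (simp add: transp_def transpose_in)

lemma BijGroup_eqI:
  assumes "g \<in> carrier (BijGroup X)" "h \<in> carrier (BijGroup X)"
    and "\<And>z. z \<in> X \<Longrightarrow> g z = h z"
  shows "g = h"
  using assms by (auto simp: BijGroup_def Bij_def intro: extensionalityI)

text \<open>This is how the auxiliary transposition \<open>\<sigma> = (s s')\<close> disappears from the quotients: \<open>\<sigma> \<sigma> = 1\<close>.\<close>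

lemma transp2_cancel:
  assumes "{s, s', a, x, b, y} \<subseteq> X"
  shows "transp2 X a x s s' \<otimes>\<^bsub>BijGroup X\<^esub> transp2 X s s' b y = transp2 X a x b y"
proof -
  interpret group "BijGroup X" by (rule group_BijGroup)
  show ?thesis
    using assms
    by (intro BijGroup_eqI) (auto simp: BijGroup_mult_apply transp2_carrier transp2_apply transpose_in)
qed

text \<open>
  With \<open>C\<^sub>a = (a x) (a y)\<close>, the word is the conjugate \<open>C\<^sub>q (C\<^sub>p\<^sup>-\<^sup>1 C\<^sub>r) C\<^sub>q\<^sup>-\<^sup>1\<close>. The inner factor
  \<open>C\<^sub>p\<^sup>-\<^sup>1 C\<^sub>r\<close> is the 3-cycle \<open>(r p x)\<close>, from which \<open>y\<close> has disappeared, and \<open>C\<^sub>q\<close> sends \<open>x\<close> to \<open>q\<close>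
  while fixing \<open>p\<close> and \<open>r\<close>.
\<close>

lemma three_cycle_word:
  assumes "{p, q, r, x, y} \<subseteq> X" "distinct [p, q, r, x, y]"
  shows "transp2 X q x q y \<otimes>\<^bsub>BijGroup X\<^esub> (transp2 X p y p x \<otimes>\<^bsub>BijGroup X\<^esub>
          (transp2 X r x r y \<otimes>\<^bsub>BijGroup X\<^esub> transp2 X q y q x)) = transp2 X r p p q"
proof -
  interpret group "BijGroup X" by (rule group_BijGroup)
  have word: "transpose q x (transpose q y (transpose p y (transpose p x (transpose r x
          (transpose r y (transpose q y (transpose q x z)))))))
        = transpose r p (transpose p q z)" for z
  proof -
    have ne: "p \<noteq> q" "p \<noteq> r" "p \<noteq> x" "p \<noteq> y" "q \<noteq> r" "q \<noteq> x" "q \<noteq> y" "r \<noteq> x" "r \<noteq> y" "x \<noteq> y"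
      using assms(2) by auto
    note ne = ne ne[symmetric]
    consider "z = p" | "z = q" | "z = r" | "z = x" | "z = y" | "z \<notin> {p, q, r, x, y}"
      by blast
    then show ?thesis
      by cases (simp_all add: ne)
  qed
  show ?thesis
    using assms(1)
    by (intro BijGroup_eqI[where X = X])
      (simp_all add: word BijGroup_mult_apply transp2_carrier transp2_apply transpose_in
        del: transpose_apply_other)
qed

section \<open>Actions of the alternating group\<close>

lemma hom_AltGroup_carrier:
  "\<phi> \<in> hom (AltGroup X) (BijGroup Y) \<Longrightarrow> g \<in> even_perms X \<Longrightarrow> \<phi> g \<in> carrier (BijGroup Y)"
  by (auto simp: hom_def AltGroup_def)

lemma hom_AltGroup_apply_closed:
  assumes "\<phi> \<in> hom (AltGroup X) (BijGroup Y)" "g \<in> even_perms X" "t \<in> Y"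
  shows "\<phi> g t \<in> Y"
  using hom_AltGroup_carrier[OF assms(1,2)] assms(3)
  by (auto simp: BijGroup_def Bij_def bij_betw_def)

lemma hom_AltGroup_apply_mult:
  assumes "\<phi> \<in> hom (AltGroup X) (BijGroup Y)"
    and "g \<in> even_perms X" "h \<in> even_perms X" "t \<in> Y"
  shows "\<phi> (g \<otimes>\<^bsub>BijGroup X\<^esub> h) t = \<phi> g (\<phi> h t)"
proof -
  have "\<phi> (g \<otimes>\<^bsub>BijGroup X\<^esub> h) = \<phi> g \<otimes>\<^bsub>BijGroup Y\<^esub> \<phi> h"
    using hom_mult[OF assms(1), of g h] assms(2,3) by (simp add: AltGroup_def)
  then show ?thesis
    using BijGroup_mult_apply[of "\<phi> g" Y "\<phi> h" t] assms by (simp add: hom_AltGroup_carrier)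
qed

lemma hom_AltGroup_one:
  assumes "\<phi> \<in> hom (AltGroup X) (BijGroup Y)"
  shows "\<phi> \<one>\<^bsub>BijGroup X\<^esub> = \<one>\<^bsub>BijGroup Y\<^esub>"
  using hom_one[OF assms group_AltGroup group_BijGroup] by (simp add: AltGroup_def)

text \<open>
  \<open>(a x) \<sigma>\<close> is the inverse of \<open>\<sigma> (a x)\<close>, where \<open>\<sigma> = (s s')\<close>. It thus brings the common image of \<open>t\<close>
  back to \<open>t\<close>, and \<open>(a x) \<sigma> \<sigma> (a y) = (a x) (a y)\<close>.
\<close>

lemma equal_images_fix:
  assumes hom: "\<phi> \<in> hom (AltGroup X) (BijGroup Y)" and "t \<in> Y"
    and X: "{s, s', a, x, y} \<subseteq> X" "s \<noteq> s'" "a \<noteq> x" "a \<noteq> y"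
    and eq: "\<phi> (transp2 X s s' a x) t = \<phi> (transp2 X s s' a y) t"
  shows "\<phi> (transp2 X a x a y) t = t"
proof -
  have even: "transp2 X a x s s' \<in> even_perms X" "transp2 X s s' a x \<in> even_perms X"
      "transp2 X s s' a y \<in> even_perms X"
    using X by (auto intro!: transp2_even)
  have one: "transp2 X a x a x = \<one>\<^bsub>BijGroup X\<^esub>"
  proof (rule BijGroup_eqI)
    show "transp2 X a x a x \<in> carrier (BijGroup X)"
      using X by (simp add: transp2_carrier)
    show "\<one>\<^bsub>BijGroup X\<^esub> \<in> carrier (BijGroup X)"
      by (rule monoid.one_closed[OF group.is_monoid[OF group_BijGroup]])
    show "transp2 X a x a x z = \<one>\<^bsub>BijGroup X\<^esub> z" if "z \<in> X" for z
      using X that by (simp add: transp2_apply) (simp add: BijGroup_def)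
  qed
  have "\<phi> (transp2 X a x a y) t = \<phi> (transp2 X a x s s') (\<phi> (transp2 X s s' a y) t)"
    using hom_AltGroup_apply_mult[OF hom even(1,3) \<open>t \<in> Y\<close>] transp2_cancel[of s s' a x a y X] X
    by simp
  also have "\<dots> = \<phi> (transp2 X a x a x) t"
    using hom_AltGroup_apply_mult[OF hom even(1,2) \<open>t \<in> Y\<close>] transp2_cancel[of s s' a x a x X] X eq
    by simp
  also have "\<dots> = t"
    using one hom_AltGroup_one[OF hom] \<open>t \<in> Y\<close> by (simp add: BijGroup_def)
  finally show ?thesis .
qed

section \<open>Actions on smaller sets\<close>

lemma pigeonhole_triple:
  assumes "infinite Y" "|Y| <o |X|" "finite F"
    and f: "f \<in> X - F \<rightarrow> Y \<times> Y \<times> Y"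
  obtains x y where "x \<in> X - F" "y \<in> X - F" "x \<noteq> y" "f x = f y"
proof -
  have "\<not> inj_on f (X - F)"
  proof
    assume "inj_on f (X - F)"
    then have "|X - F| \<le>o |Y \<times> Y \<times> Y|"
      by (rule card_of_ordLeqI) (rule funcset_mem[OF f])
    moreover have "|Y \<times> Y \<times> Y| =o |Y|"
    proof (rule card_of_Times_infinite_simps(1)[OF assms(1)])
      show "Y \<times> Y \<noteq> {}"
        using assms(1) by auto
      show "|Y \<times> Y| \<le>o |Y|"
        by (rule ordIso_imp_ordLeq[OF card_of_Times_same_infinite[OF assms(1)]])
    qed
    ultimately have "|X - F| \<le>o |Y|"
      by (rule ordLeq_ordIso_trans)
    moreover have "|F| \<le>o |Y|"
      using ordLeq_total[OF card_of_Well_order card_of_Well_order, of F Y]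
        card_of_ordLeq_finite[OF _ assms(3)] assms(1) by metis
    ultimately have "|(X - F) \<union> F| \<le>o |Y|"
      using assms(1) by (intro card_of_Un_ordLeq_infinite_Field) (simp_all add: card_of_card_order_on Field_card_of)
    moreover have "|X| \<le>o |(X - F) \<union> F|"
      by (rule card_of_mono1) blast
    ultimately have "|X| \<le>o |Y|"
      using ordLeq_transitive by blast
    then show False
      using not_ordLess_ordLeq[OF assms(2)] by contradiction
  qed
  then show thesis
    using that unfolding inj_on_def by blast
qed

lemma three_cycle_in_kernel:
  assumes hom: "\<phi> \<in> hom (AltGroup X) (BijGroup Y)"
    and Y: "infinite Y" "|Y| <o |X|"
    and pqr: "{p, q, r} \<subseteq> X" "distinct [p, q, r]"
  shows "\<phi> (transp2 X r p p q) = \<one>\<^bsub>BijGroup Y\<^esub>"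
proof (rule BijGroup_eqI)
  have even: "transp2 X r p p q \<in> even_perms X"
    using pqr by (intro transp2_even) auto
  then show "\<phi> (transp2 X r p p q) \<in> carrier (BijGroup Y)"
    by (rule hom_AltGroup_carrier[OF hom])
  show "\<one>\<^bsub>BijGroup Y\<^esub> \<in> carrier (BijGroup Y)"
    by (rule monoid.one_closed[OF group.is_monoid[OF group_BijGroup]])
  fix t assume t: "t \<in> Y"
  \<comment> \<open>The role of \<open>\<sigma>\<close> is played by \<open>(p q)\<close>.\<close>
  let ?c = "\<lambda>a x. \<phi> (transp2 X p q a x) t"
  have colours: "(\<lambda>x. (?c p x, ?c q x, ?c r x)) \<in> X - {p, q, r} \<rightarrow> Y \<times> Y \<times> Y"
    using pqr by (auto intro!: hom_AltGroup_apply_closed[OF hom _ t] transp2_even)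
  obtain x y where xy: "x \<in> X - {p, q, r}" "y \<in> X - {p, q, r}" "x \<noteq> y"
    and "(?c p x, ?c q x, ?c r x) = (?c p y, ?c q y, ?c r y)"
    by (rule pigeonhole_triple[OF Y _ colours]) simp
  then have c: "?c p x = ?c p y" "?c q x = ?c q y" "?c r x = ?c r y"
    by simp_all
  have fix_t: "\<phi> (transp2 X q x q y) t = t" "\<phi> (transp2 X p y p x) t = t"
      "\<phi> (transp2 X r x r y) t = t" "\<phi> (transp2 X q y q x) t = t"
    using pqr xy c by (auto intro!: equal_images_fix[OF hom t, of p q])
  have evens: "transp2 X q x q y \<in> even_perms X" "transp2 X p y p x \<in> even_perms X"
      "transp2 X r x r y \<in> even_perms X" "transp2 X q y q x \<in> even_perms X"
    using pqr xy by (auto intro!: transp2_even)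
  note closed = subgroup.m_closed[OF subgroup_even_perms]
  have "\<phi> (transp2 X q x q y \<otimes>\<^bsub>BijGroup X\<^esub> (transp2 X p y p x \<otimes>\<^bsub>BijGroup X\<^esub>
          (transp2 X r x r y \<otimes>\<^bsub>BijGroup X\<^esub> transp2 X q y q x))) t = t"
    by (simp add: hom_AltGroup_apply_mult[OF hom _ _ t] evens closed fix_t)
  then have "\<phi> (transp2 X r p p q) t = t"
    using three_cycle_word[of p q r x y X] pqr xy by auto
  then show "\<phi> (transp2 X r p p q) t = \<one>\<^bsub>BijGroup Y\<^esub> t"
    using t by (simp add: BijGroup_def)
qed

theorem theorem1:
  fixes \<kappa> :: "'a rel" and \<mu> :: "'b rel"
  assumes "Card_order \<kappa>" and "infinite (Field \<kappa>)"
    and "Card_order \<mu>" and "infinite (Field \<mu>)"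
    and "\<kappa> <o \<mu>"
  shows "\<not> (\<exists>\<phi>. \<phi> \<in> hom (AltGroup (Field \<mu>)) (BijGroup (Field \<kappa>)) \<and>
                inj_on \<phi> (carrier (AltGroup (Field \<mu>))))"
proof
  let ?X = "Field \<mu>" and ?Y = "Field \<kappa>"
  assume "\<exists>\<phi>. \<phi> \<in> hom (AltGroup ?X) (BijGroup ?Y) \<and> inj_on \<phi> (carrier (AltGroup ?X))"
  then obtain \<phi> where hom: "\<phi> \<in> hom (AltGroup ?X) (BijGroup ?Y)"
    and "inj_on \<phi> (carrier (AltGroup ?X))"
    by blast
  then have inj: "inj_on \<phi> (even_perms ?X)"
    by (simp add: AltGroup_def)
  have less: "|?Y| <o |?X|"
    using ordIso_ordLess_trans[OF card_of_Field_ordIso[OF assms(1)] assms(5)]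
      ordIso_symmetric[OF card_of_Field_ordIso[OF assms(3)]]
    by (rule ordLess_ordIso_trans)
  obtain B where "B \<subseteq> ?X" "card B = 3"
    using infinite_arbitrarily_large[OF assms(4)] by blast
  then obtain p q r where pqr: "{p, q, r} \<subseteq> ?X" "distinct [p, q, r]"
    unfolding card_3_iff by fastforce
  have "\<phi> (transp2 ?X r p p q) = \<phi> \<one>\<^bsub>BijGroup ?X\<^esub>"
    using three_cycle_in_kernel[OF hom assms(2) less pqr] hom_AltGroup_one[OF hom] by simp
  moreover have "transp2 ?X r p p q \<in> even_perms ?X"
    using pqr by (intro transp2_even) auto
  ultimately have "transp2 ?X r p p q = \<one>\<^bsub>BijGroup ?X\<^esub>"
    using inj_onD[OF inj] subgroup.one_closed[OF subgroup_even_perms] by blast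
  \<comment> \<open>But the 3-cycle sends \<open>p\<close> to \<open>q\<close>.\<close>
  moreover have "transp2 ?X r p p q p = q"
    using pqr by (auto simp: transp2_apply transpose_def)
  ultimately show False
    using pqr by (simp add: BijGroup_def)
qed

end
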